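(* Let $D$ be a bias function that is interior, satisfies eventual learning of states, and is balanced. Then the sender S gains from sequential persuasion in every Crawford-Sobel environment (in which the receiver R has bias $D$).
   Context: Basic notation. $\Omega$ is the finite set of states; $\Delta(\Omega)$ is the set of probability vectors in $\mathbb{R}^\Omega$; $\Delta^o(\Omega)$ is the set of full-support beliefs; $\delta_\omega$ is the point mass at $\omega$. For a set $Y$, $\Delta(Y)$ denotes the set of finite-support probability distributions on $Y$; $Conv$ is the convex hull. Crawford-Sobel environment. The (finite) state space is $\Omega\subseteq\mathbb{R}$ and R's action set is $A=\mathbb{R}$. R's utility is $u(\omega,a)=-(a-\omega)^2$ and S's utility is $v(\omega,a)=-(a-(\omega+b))^2$ for some $b\in\mathbb{R}$. S and R share a full-support common prior $\mu_0\in\Delta^o(\Omega)$. R's optimal action at belief $\mu$ is $\hat a(\mu)=\mathbb{E}_{\omega\sim\mu}[\omega]$. Bias. A bias function is a map $D:\Delta^o(\Omega)\times\Delta(\Omega)\to\Delta(\Omega)$; $D(\nu,\nu')$ is the belief R holds given prior $\nu$ and Bayesian posterior $\nu'$. Let $D^1(\nu,\nu')=D(\nu,\nu')$ and $D^n(\nu,\nu')=D(D^{n-1}(\nu,\nu'),\nu')$ for $n>1$. - $D$ is interior if $D(\nu,\nu')\in\Delta^o(\Omega)$ for all $\nu\in\Delta^o(\Omega)$, $\nu'\in\Delta(\Omega)$. - $D$ satisfies eventual learning of states if $\lim_n D^n(\nu,\delta_\omega)=\delta_\omega$ for all $\nu\in\Delta^o(\Omega)$, $\omega\in\Omega$. -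 $D$ is balanced if for every $\nu\in\Delta^o(\Omega)$ and every finite collection $\{\nu'_1,\ldots,\nu'_K\}\subseteq\Delta(\Omega)$ with $\nu\in Conv(\{\nu'_1,\ldots,\nu'_K\})$, one has $\underline 0\in Conv(\{D(\nu,\nu'_1)-\nu'_1,\ldots,D(\nu,\nu'_K)-\nu'_K\})$, where $\underline 0$ is the zero vector of $\mathbb{R}^\Omega$. One-shot persuasion. S's optimal payoff with a single signal is $$V_D(\mu_0)=\max_\tau \sum_{\mu\in Supp(\tau)}\tau(\mu)\,\mathbb{E}_{\omega\sim\mu}[v(\omega,\hat a(D(\mu_0,\mu)))]\quad\text{s.t. } \sum_{\mu\in Supp(\tau)}\tau(\mu)\mu=\mu_0,$$ over finite-support $\tau\in\Delta(\Delta(\Omega))$. Sequential persuasion. $X$ is the set of signals; an information structure is a map $\Omega\to\Delta(X)$. A sequential persuasion strategy $\sigma$ specifies, as a function of the history $(x_1,\ldots,x_{n-1})$ of realized signals, either an information structure $\sigma_{x_1,\ldots,x_{n-1}}$ to be used next or termination; persuasion must terminate in finite time (the length may depend on realizations). R's belief starts at $\mu_0$ and is updated recursively: $\mu^\sigma(x_1,\ldots,x_n)=D(\mu^\sigma(x_1,\ldots,x_{n-1}),\mu)$, where $\mu$ is the Bayesian posterior computed from prior $\mu^\sigma(x_1,\ldots,x_{n-1})$, the information structure $\sigma_{x_1,\ldots,x_{n-1}}$ and the realized signal $x_n$ (with $\mu^\sigma(\emptyset)=\mu_0$). Conditional on state $\omega$, a signal sequence has probability $\prod_{k}\sigma_{x_1,\ldots,x_{k-1}}(x_k|\omega)$.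 S's payoff from $\sigma$ is the expectation, over $\omega\sim\mu_0$ and the terminal signal sequence, of $v(\omega,\hat a(\mu'))$, where $\mu'$ is R's final belief. S gains from sequential persuasion if there is a sequential persuasion strategy whose payoff to S is strictly higher than $V_D(\mu_0)$.
   Formalization: Proved for environments with at least two states, an infinite set of signals, and a one-shot maximum V_D(μ0) that is attained; with one state no gain is possible, and for discontinuous D the maximum may not exist. *)

theory Defs
  imports "HOL-Probability.Probability_Mass_Function"
begin

text \<open>
  The finite state space is the finite type \<^typ>\<open>'w\<close>; an injection \<open>st :: 'w \<Rightarrow> real\<close> presents it
  as a finite subset of the reals. Beliefs are vectors of type \<open>real ^ 'w\<close>, so convex hulls and
  limits are those of Euclidean space.
\<close>

definition beliefs :: "(real ^ 'w::finite) set" where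
  "beliefs = {\<mu>. (\<forall>w. 0 \<le> \<mu> $ w) \<and> (\<Sum>w\<in>UNIV. \<mu> $ w) = 1}"

definition full_support_beliefs :: "(real ^ 'w::finite) set" where
  "full_support_beliefs = {\<mu> \<in> beliefs. \<forall>w. 0 < \<mu> $ w}"

definition point_mass :: "'w::finite \<Rightarrow> real ^ 'w" where
  "point_mass w = axis w 1"


subsection \<open>The Crawford-Sobel environment\<close>

definition receiver_utility :: "('w::finite \<Rightarrow> real) \<Rightarrow> 'w \<Rightarrow> real \<Rightarrow> real" where
  "receiver_utility st w a = - (a - st w)\<^sup>2"

definition sender_utility :: "('w::finite \<Rightarrow> real) \<Rightarrow> real \<Rightarrow> 'w \<Rightarrow> real \<Rightarrow> real" where
  "sender_utility st b w a = - (a - (st w + b))\<^sup>2"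

definition belief_expectation :: "real ^ 'w::finite \<Rightarrow> ('w \<Rightarrow> real) \<Rightarrow> real" where
  "belief_expectation \<mu> f = (\<Sum>w\<in>UNIV. \<mu> $ w * f w)"

definition optimal_action :: "('w::finite \<Rightarrow> real) \<Rightarrow> real ^ 'w \<Rightarrow> real" where
  "optimal_action st \<mu> = belief_expectation \<mu> st"

lemma optimal_action_unique_maximizer:
  fixes \<mu> :: "real ^ 'w::finite"
  assumes "\<mu> \<in> beliefs" and "a \<noteq> optimal_action st \<mu>"
  shows "belief_expectation \<mu> (\<lambda>w. receiver_utility st w a)
       < belief_expectation \<mu> (\<lambda>w. receiver_utility st w (optimal_action st \<mu>))"
proof -
  define m where "m = optimal_action st \<mu>"
  define q where "q = (\<Sum>w\<in>UNIV. \<mu> $ w * (st w)\<^sup>2)"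
  have one: "(\<Sum>w\<in>UNIV. \<mu> $ w) = 1" using assms(1) by (simp add: beliefs_def)
  have m: "(\<Sum>w\<in>UNIV. \<mu> $ w * st w) = m"
    by (simp add: m_def optimal_action_def belief_expectation_def)
  have eq: "belief_expectation \<mu> (\<lambda>w. receiver_utility st w c) = - c\<^sup>2 + 2 * c * m - q" for c
  proof -
    have "belief_expectation \<mu> (\<lambda>w. receiver_utility st w c)
        = (\<Sum>w\<in>UNIV. (- c\<^sup>2) * \<mu> $ w + (2 * c) * (\<mu> $ w * st w) - \<mu> $ w * (st w)\<^sup>2)"
      unfolding belief_expectation_def receiver_utility_def
      by (rule sum.cong) (auto simp: power2_eq_square algebra_simps)
    also have "\<dots> = (- c\<^sup>2) * (\<Sum>w\<in>UNIV. \<mu> $ w) + (2 * c) * (\<Sum>w\<in>UNIV. \<mu> $ w * st w) - q"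
      by (simp only: sum.distrib sum_subtractf sum_distrib_left q_def)
    finally show ?thesis by (simp only: one m)
  qed
  have "0 < (a - m)\<^sup>2" using assms(2) by (simp add: m_def)
  then have "- a\<^sup>2 + 2 * a * m - q < - m\<^sup>2 + 2 * m * m - q"
    by (simp add: power2_eq_square algebra_simps)
  then show ?thesis by (simp only: eq m_def[symmetric])
qed


subsection \<open>Bias functions\<close>

text \<open>
  A bias function is a total HOL function; only its values on
  \<^term>\<open>full_support_beliefs \<times> beliefs\<close> matter.
\<close>

type_synonym 'w bias = "real ^ 'w \<Rightarrow> real ^ 'w \<Rightarrow> real ^ 'w"

definition bias_function :: "'w::finite bias \<Rightarrow> bool" where
  "bias_function D \<longleftrightarrow> (\<forall>\<nu>\<in>full_support_beliefs. \<forall>\<nu>'\<in>beliefs. D \<nu> \<nu>' \<in> beliefs)"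

definition interior_bias :: "'w::finite bias \<Rightarrow> bool" where
  "interior_bias D \<longleftrightarrow>
     (\<forall>\<nu>\<in>full_support_beliefs. \<forall>\<nu>'\<in>beliefs. D \<nu> \<nu>' \<in> full_support_beliefs)"

text \<open>The value at \<open>n = 0\<close> is the prior \<open>\<nu>\<close>.\<close>

primrec bias_iterate :: "'w::finite bias \<Rightarrow> nat \<Rightarrow> real ^ 'w \<Rightarrow> real ^ 'w \<Rightarrow> real ^ 'w" where
  "bias_iterate D 0 \<nu> \<nu>' = \<nu>"
| "bias_iterate D (Suc n) \<nu> \<nu>' = D (bias_iterate D n \<nu> \<nu>') \<nu>'"

definition eventual_learning :: "'w::finite bias \<Rightarrow> bool" where
  "eventual_learning D \<longleftrightarrow>
     (\<forall>\<nu>\<in>full_support_beliefs. \<forall>w.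
        (\<lambda>n. bias_iterate D n \<nu> (point_mass w)) \<longlonglongrightarrow> point_mass w)"

definition balanced_bias :: "'w::finite bias \<Rightarrow> bool" where
  "balanced_bias D \<longleftrightarrow>
     (\<forall>\<nu>\<in>full_support_beliefs. \<forall>N. finite N \<and> N \<subseteq> beliefs \<and> \<nu> \<in> convex hull N \<longrightarrow>
        0 \<in> convex hull ((\<lambda>\<nu>'. D \<nu> \<nu>' - \<nu>') ` N))"


subsection \<open>One-shot persuasion\<close>

definition belief_splittings :: "real ^ 'w::finite \<Rightarrow> (real ^ 'w) pmf set" where
  "belief_splittings \<mu>0 =
     {\<tau>. finite (set_pmf \<tau>) \<and> set_pmf \<tau> \<subseteq> beliefs \<and> (\<Sum>\<mu>\<in>set_pmf \<tau>. pmf \<tau> \<mu> *\<^sub>R \<mu>) = \<mu>0}"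

definition one_shot_payoff ::
  "('w::finite \<Rightarrow> real) \<Rightarrow> real \<Rightarrow> 'w bias \<Rightarrow> real ^ 'w \<Rightarrow> (real ^ 'w) pmf \<Rightarrow> real" where
  "one_shot_payoff st b D \<mu>0 \<tau> =
     (\<Sum>\<mu>\<in>set_pmf \<tau>. pmf \<tau> \<mu> *
        belief_expectation \<mu> (\<lambda>w. sender_utility st b w (optimal_action st (D \<mu>0 \<mu>))))"

text \<open>
  The maximum over all splittings of the prior. It is unspecified when no splitting attains it,
  which can happen for discontinuous biases.
\<close>

definition one_shot_value :: "('w::finite \<Rightarrow> real) \<Rightarrow> real \<Rightarrow> 'w bias \<Rightarrow> real ^ 'w \<Rightarrow> real" where
  "one_shot_value st b D \<mu>0 =
     (GREATEST r. r \<in> one_shot_payoff st b D \<mu>0 ` belief_splittings \<mu>0)"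

lemma one_shot_value_eq:
  assumes "is_arg_max (one_shot_payoff st b D \<mu>0) (\<lambda>\<tau>. \<tau> \<in> belief_splittings \<mu>0) \<tau>"
  shows "one_shot_value st b D \<mu>0 = one_shot_payoff st b D \<mu>0 \<tau>"
  unfolding one_shot_value_def
  using assms by (intro Greatest_equality) (auto simp: is_arg_max_def not_less)


subsection \<open>Sequential persuasion\<close>

type_synonym ('w, 'x) info_structure = "'w \<Rightarrow> 'x pmf"

definition info_structures :: "'x set \<Rightarrow> ('w::finite, 'x) info_structure set" where
  "info_structures X = {\<pi>. \<forall>w. finite (set_pmf (\<pi> w)) \<and> set_pmf (\<pi> w) \<subseteq> X}"

text \<open>
  A strategy maps each history, listed in chronological order, to the information structure used
  next or to \<^const>\<open>None\<close>, which stands for termination.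
\<close>

type_synonym ('w, 'x) strategy = "'x list \<Rightarrow> ('w, 'x) info_structure option"

text \<open>
  Conditional probability, given the state, that persuasion runs through the history \<open>h\<close>;
  it is zero if the strategy terminates at a proper prefix of \<open>h\<close>.
\<close>

definition history_prob :: "('w::finite, 'x) strategy \<Rightarrow> 'w \<Rightarrow> 'x list \<Rightarrow> real" where
  "history_prob \<sigma> w h =
     (\<Prod>k<length h. case \<sigma> (take k h) of None \<Rightarrow> 0 | Some \<pi> \<Rightarrow> pmf (\<pi> w) (h ! k))"

definition realizable :: "('w::finite, 'x) strategy \<Rightarrow> 'x list \<Rightarrow> bool" where
  "realizable \<sigma> h \<longleftrightarrow> (\<exists>w. 0 < history_prob \<sigma> w h)"

text \<open>
  Termination in finite time: there is no infinite signal sequence all of whose finite prefixes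
  are realizable. No uniform bound on the length is imposed.
\<close>

definition persuasion_strategies :: "'x set \<Rightarrow> ('w::finite, 'x) strategy set" where
  "persuasion_strategies X =
     {\<sigma>. (\<forall>h\<in>lists X. \<forall>\<pi>. \<sigma> h = Some \<pi> \<longrightarrow> \<pi> \<in> info_structures X) \<and>
          \<not> (\<exists>x :: nat \<Rightarrow> 'x. \<forall>n. realizable \<sigma> (map x [0..<n]))}"

definition terminal_histories :: "('w::finite, 'x) strategy \<Rightarrow> 'x list set" where
  "terminal_histories \<sigma> = {h. \<sigma> h = None \<and> realizable \<sigma> h}"

definition bayes_posterior ::
  "real ^ 'w::finite \<Rightarrow> ('w, 'x) info_structure \<Rightarrow> 'x \<Rightarrow> real ^ 'w" where
  "bayes_posterior \<nu> \<pi> x =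
     (\<chi> w. \<nu> $ w * pmf (\<pi> w) x / (\<Sum>w'\<in>UNIV. \<nu> $ w' * pmf (\<pi> w') x))"

text \<open>The receiver's belief after the first \<open>n\<close> signals of the history \<open>h\<close>.\<close>

primrec belief_after ::
  "'w::finite bias \<Rightarrow> real ^ 'w \<Rightarrow> ('w, 'x) strategy \<Rightarrow> 'x list \<Rightarrow> nat \<Rightarrow> real ^ 'w" where
  "belief_after D \<mu>0 \<sigma> h 0 = \<mu>0"
| "belief_after D \<mu>0 \<sigma> h (Suc n) =
     D (belief_after D \<mu>0 \<sigma> h n)
       (bayes_posterior (belief_after D \<mu>0 \<sigma> h n) (the (\<sigma> (take n h))) (h ! n))"

definition receiver_belief ::
  "'w::finite bias \<Rightarrow> real ^ 'w \<Rightarrow> ('w, 'x) strategy \<Rightarrow> 'x list \<Rightarrow> real ^ 'w" where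
  "receiver_belief D \<mu>0 \<sigma> h = belief_after D \<mu>0 \<sigma> h (length h)"

definition sequential_payoff ::
  "('w::finite \<Rightarrow> real) \<Rightarrow> real \<Rightarrow> 'w bias \<Rightarrow> real ^ 'w \<Rightarrow> ('w, 'x) strategy \<Rightarrow> real" where
  "sequential_payoff st b D \<mu>0 \<sigma> =
     belief_expectation \<mu>0 (\<lambda>w. \<Sum>h\<in>terminal_histories \<sigma>.
       history_prob \<sigma> w h *
         sender_utility st b w (optimal_action st (receiver_belief D \<mu>0 \<sigma> h)))"

definition gains_from_sequential_persuasion ::
  "'x set \<Rightarrow> ('w::finite \<Rightarrow> real) \<Rightarrow> real \<Rightarrow> 'w bias \<Rightarrow> real ^ 'w \<Rightarrow> bool" where
  "gains_from_sequential_persuasion X st b D \<mu>0 \<longleftrightarrow>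
     (\<exists>\<sigma>\<in>persuasion_strategies X.
        one_shot_value st b D \<mu>0 < sequential_payoff st b D \<mu>0 \<sigma>)"


text \<open>
  The inner sum in \<^const>\<open>sequential_payoff\<close> ranges over a finite set, by Koenig's lemma.
\<close>

lemma history_prob_Nil [simp]: "history_prob \<sigma> w [] = 1"
  by (simp add: history_prob_def)

lemma history_prob_snoc:
  "history_prob \<sigma> w (h @ [x]) =
     history_prob \<sigma> w h * (case \<sigma> h of None \<Rightarrow> 0 | Some \<pi> \<Rightarrow> pmf (\<pi> w) x)"
proof -
  have "history_prob \<sigma> w (h @ [x]) =
      (\<Prod>k<length h. case \<sigma> (take k (h @ [x])) of None \<Rightarrow> 0 | Some \<pi> \<Rightarrow> pmf (\<pi> w) ((h @ [x]) ! k)) *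
      (case \<sigma> h of None \<Rightarrow> 0 | Some \<pi> \<Rightarrow> pmf (\<pi> w) x)"
    by (cases "\<sigma> h") (simp_all add: history_prob_def)
  also have "(\<Prod>k<length h. case \<sigma> (take k (h @ [x])) of None \<Rightarrow> 0 | Some \<pi> \<Rightarrow> pmf (\<pi> w) ((h @ [x]) ! k))
      = history_prob \<sigma> w h"
    unfolding history_prob_def by (rule prod.cong) (auto simp: nth_append split: option.split)
  finally show ?thesis .
qed

lemma history_prob_nonneg: "0 \<le> history_prob \<sigma> w h"
  unfolding history_prob_def by (rule prod_nonneg) (auto split: option.split)

lemma realizable_snocD:
  assumes "realizable \<sigma> (h @ [x])"
  shows "realizable \<sigma> h" and "\<exists>\<pi> w. \<sigma> h = Some \<pi> \<and> x \<in> set_pmf (\<pi> w)"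
proof -
  obtain w where w: "0 < history_prob \<sigma> w (h @ [x])" using assms by (auto simp: realizable_def)
  then have nz: "history_prob \<sigma> w h \<noteq> 0"
    and c: "(case \<sigma> h of None \<Rightarrow> 0 | Some \<pi> \<Rightarrow> pmf (\<pi> w) x) \<noteq> 0"
    by (auto simp: history_prob_snoc)
  show "realizable \<sigma> h"
    using nz history_prob_nonneg[of \<sigma> w h] unfolding realizable_def by (metis less_eq_real_def)
  show "\<exists>\<pi> w. \<sigma> h = Some \<pi> \<and> x \<in> set_pmf (\<pi> w)"
    using c by (auto split: option.splits simp: set_pmf_iff)
qed

lemma realizable_append: "realizable \<sigma> (h @ g) \<Longrightarrow> realizable \<sigma> h"
proof (induction g rule: rev_induct)
  case (snoc x g)
  then show ?case using realizable_snocD(1)[of \<sigma> "h @ g" x] by simp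
qed simp

lemma realizable_in_lists:
  assumes "\<sigma> \<in> persuasion_strategies X" and "realizable \<sigma> h"
  shows "h \<in> lists X"
  using assms(2)
proof (induction h rule: rev_induct)
  case (snoc x h)
  have h: "h \<in> lists X" using snoc.IH realizable_snocD(1)[OF snoc.prems] .
  obtain \<pi> w where "\<sigma> h = Some \<pi>" "x \<in> set_pmf (\<pi> w)"
    using realizable_snocD(2)[OF snoc.prems] by blast
  moreover from this have "\<pi> \<in> info_structures X"
    using h assms(1) unfolding persuasion_strategies_def by blast
  ultimately have "x \<in> X" by (auto simp: info_structures_def)
  then show ?case using h by simp
qed simp

lemma finite_realizable:
  assumes "\<sigma> \<in> persuasion_strategies X"
  shows "finite {h. realizable \<sigma> h}"
proof (rule ccontr)
  assume inf: "infinite {h. realizable \<sigma> h}"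
  define E where "E h = {g. realizable \<sigma> (h @ g)}" for h
  have step: "\<exists>x. infinite (E (h @ [x]))" if h: "infinite (E h)" for h
  proof -
    define S where "S = {x. realizable \<sigma> (h @ [x])}"
    have rh: "realizable \<sigma> h"
    proof -
      have "E h \<noteq> {}" using h by auto
      then show ?thesis using realizable_append by (auto simp: E_def)
    qed
    have "finite S"
    proof (cases "\<sigma> h")
      case None
      then have "S = {}" using realizable_snocD(2) by (fastforce simp: S_def)
      then show ?thesis by simp
    next
      case (Some \<pi>)
      have "S \<subseteq> (\<Union>w. set_pmf (\<pi> w))"
        using realizable_snocD(2) Some by (fastforce simp: S_def)
      moreover have "\<pi> \<in> info_structures X"
        using assms Some realizable_in_lists[OF assms rh]
        unfolding persuasion_strategies_def by blast
      then have "finite (\<Union>w. set_pmf (\<pi> w))" by (simp add: info_structures_def)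
      ultimately show ?thesis using finite_subset by blast
    qed
    moreover have "E h \<subseteq> insert [] (\<Union>x\<in>S. (#) x ` E (h @ [x]))"
    proof
      fix g assume g: "g \<in> E h"
      show "g \<in> insert [] (\<Union>x\<in>S. (#) x ` E (h @ [x]))"
      proof (cases g)
        case (Cons x g')
        then have r: "realizable \<sigma> ((h @ [x]) @ g')" using g by (simp add: E_def)
        then have "x \<in> S" using realizable_append unfolding S_def by blast
        then show ?thesis using r Cons by (auto simp: E_def)
      qed simp
    qed
    ultimately show ?thesis
      using h by (meson finite.insertI finite_UN finite_imageI finite_subset)
  qed
  define nxt where "nxt h = (SOME x. infinite (E (h @ [x])))" for h
  define H where "H n = ((\<lambda>h. h @ [nxt h]) ^^ n) []" for n :: nat
  define x where "x n = nxt (H n)" for n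
  have Hinf: "infinite (E (H n))" for n
  proof (induction n)
    case 0
    then show ?case using inf by (simp add: H_def E_def)
  next
    case (Suc n)
    then have "infinite (E (H n @ [nxt (H n)]))"
      unfolding nxt_def by (rule someI_ex[OF step])
    then show ?case by (simp add: H_def)
  qed
  have Hx: "H n = map x [0..<n]" for n
    by (induction n) (simp_all add: H_def x_def)
  have "realizable \<sigma> (H n)" for n
  proof -
    have "E (H n) \<noteq> {}" using Hinf[of n] by auto
    then show ?thesis using realizable_append by (auto simp: E_def)
  qed
  then have "\<forall>n. realizable \<sigma> (map x [0..<n])" by (simp add: Hx)
  then show False using assms by (auto simp: persuasion_strategies_def)
qed

lemma finite_terminal_histories:
  "\<sigma> \<in> persuasion_strategies X \<Longrightarrow> finite (terminal_histories \<sigma>)"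
  using finite_realizable by (rule rev_finite_subset) (auto simp: terminal_histories_def)

end

theory Submission
  imports Defs
begin

text \<open>
  Fully revealing the state again and again brings the receiver's action close to the true state,
  so from any interior belief the sender can secure a payoff close to \<open>- b\<^sup>2\<close>. It therefore suffices
  that the optimal splitting puts weight on a posterior \<open>\<mu>\<close> at which the conditional payoff is
  strictly below \<open>- b\<^sup>2\<close>: the sender follows the optimal splitting and keeps revealing the state
  after \<open>\<mu>\<close>.

  Suppose there were no such posterior. Writing \<open>a\<^sub>k\<close> for the action after \<open>\<mu>\<^sub>k\<close>, this says
  \<open>E\<^sub>k (a\<^sub>k - \<omega>)\<^sup>2 \<le> 2 b (a\<^sub>k - E\<^sub>k \<omega>)\<close> for all \<open>k\<close>. Averaging with the weights of the balance condition
  annihilates the right-hand side, so \<open>a\<^sub>k = \<omega>\<close> whenever \<open>\<mu>\<^sub>k\<close> has positive balance weight and charges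
  \<open>\<omega>\<close>. Since the distorted beliefs have full support and average to the same vector as the \<open>\<mu>\<^sub>k\<close>,
  the smallest state is charged by such a \<open>\<mu>\<^sub>k\<close>; but an interior belief induces a strictly larger
  action than the smallest state.
\<close>

section \<open>Beliefs and the action they induce\<close>

lemma beliefs_nonneg: "\<mu> \<in> beliefs \<Longrightarrow> 0 \<le> \<mu> $ w"
  by (simp add: beliefs_def)

lemma beliefs_sum: "\<mu> \<in> beliefs \<Longrightarrow> (\<Sum>w\<in>UNIV. \<mu> $ w) = 1"
  by (simp add: beliefs_def)

lemma full_support_pos: "\<mu> \<in> full_support_beliefs \<Longrightarrow> 0 < \<mu> $ w"
  by (simp add: full_support_beliefs_def)

lemma full_support_imp_beliefs: "\<mu> \<in> full_support_beliefs \<Longrightarrow> \<mu> \<in> beliefs"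
  by (simp add: full_support_beliefs_def)

lemma point_mass_nth: "point_mass w $ w' = (if w' = w then 1 else 0)"
  by (simp add: point_mass_def axis_def)

lemma point_mass_beliefs: "point_mass w \<in> beliefs"
  by (simp add: beliefs_def point_mass_nth)

lemma optimal_action_point_mass: "optimal_action st (point_mass w) = st w"
proof -
  have "(\<Sum>w'\<in>UNIV. point_mass w $ w' * st w') = (\<Sum>w'\<in>UNIV. if w' = w then st w' else 0)"
    by (rule sum.cong) (auto simp: point_mass_nth)
  then show ?thesis by (simp add: optimal_action_def belief_expectation_def)
qed

lemma tendsto_optimal_action:
  "(f \<longlongrightarrow> \<mu>) F \<Longrightarrow> ((\<lambda>n. optimal_action st (f n)) \<longlongrightarrow> optimal_action st \<mu>) F"
  unfolding optimal_action_def belief_expectation_def by (intro tendsto_intros)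

text \<open>A second state exists, lies strictly higher by injectivity, and has positive mass, so it
  pulls the mean above the minimum.\<close>

lemma optimal_action_gt_minimal_state:
  assumes "inj st" and "2 \<le> CARD('w::finite)" and "\<mu> \<in> full_support_beliefs"
    and "\<And>w'. st w \<le> st w'"
  shows "st (w::'w) < optimal_action st \<mu>"
proof -
  obtain w' where w': "w' \<noteq> w"
    using assms(2) by (metis One_nat_def Suc_1 card_le_Suc0_iff_eq finite not_less_eq_eq)
  then have "st w < st w'"
    using assms(1,4) by (metis inj_eq order_le_imp_less_or_eq)
  then have "(\<Sum>v\<in>UNIV. \<mu> $ v * st w) < (\<Sum>v\<in>UNIV. \<mu> $ v * st v)"
    using assms(3,4) full_support_pos[OF assms(3)]
    by (intro sum_strict_mono_ex1) (auto intro!: mult_left_mono simp: less_imp_le)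
  then show ?thesis
    using beliefs_sum[OF full_support_imp_beliefs[OF assms(3)]]
    by (simp add: optimal_action_def belief_expectation_def sum_distrib_right[symmetric])
qed

section \<open>Balance forces a posterior with low payoff\<close>

text \<open>The hull is unfolded in its indexed form and a preimage is chosen for each index. This
  avoids sums over the image set, in which posteriors with equal displacement
  \<open>D \<nu> \<nu>' - \<nu>'\<close> would be merged.\<close>

lemma balance_weights:
  fixes D :: "'w::finite bias"
  assumes "balanced_bias D" and "\<nu> \<in> full_support_beliefs"
    and "finite N" and "N \<subseteq> beliefs" and "\<nu> \<in> convex hull N"
  obtains n :: nat and u y where "\<And>i. i \<in> {1..n} \<Longrightarrow> 0 \<le> u i" and "\<And>i. i \<in> {1..n} \<Longrightarrow> y i \<in> N"
    and "(\<Sum>i=1..n. u i *\<^sub>R D \<nu> (y i)) = (\<Sum>i=1..n. u i *\<^sub>R y i)" and "sum u {1..n} = 1"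
proof -
  have "0 \<in> convex hull ((\<lambda>\<nu>'. D \<nu> \<nu>' - \<nu>') ` N)"
    using assms unfolding balanced_bias_def by blast
  then obtain n :: nat and u x where u: "\<forall>i\<in>{1..n}. 0 \<le> u i \<and> x i \<in> (\<lambda>\<nu>'. D \<nu> \<nu>' - \<nu>') ` N"
    "sum u {1..n} = 1" "(\<Sum>i=1..n. u i *\<^sub>R x i) = 0"
    unfolding convex_hull_indexed by auto
  then have "\<forall>i\<in>{1..n}. \<exists>y. y \<in> N \<and> x i = D \<nu> y - y" by blast
  then obtain y where y: "\<And>i. i \<in> {1..n} \<Longrightarrow> y i \<in> N \<and> x i = D \<nu> (y i) - y i" by metis
  have "(\<Sum>i=1..n. u i *\<^sub>R x i) = (\<Sum>i=1..n. u i *\<^sub>R D \<nu> (y i) - u i *\<^sub>R y i)"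
    using y by (intro sum.cong) (auto simp: scaleR_diff_right)
  then have "(\<Sum>i=1..n. u i *\<^sub>R D \<nu> (y i)) = (\<Sum>i=1..n. u i *\<^sub>R y i)"
    using u(3) by (simp add: sum_subtractf)
  then show thesis using that u y by blast
qed

text \<open>The threshold \<open>- b\<^sup>2\<close> is what the sender gets when the action equals
  the true state. The sender gains from a distorted action only through a term linear in the
  distortion, which balance cancels on average, while the squared error remains.\<close>

lemma low_payoff_posterior:
  fixes D :: "'w::finite bias"
  assumes "inj st" and "2 \<le> CARD('w)" and "interior_bias D" and "balanced_bias D"
    and "\<nu> \<in> full_support_beliefs" and "finite N" and "N \<subseteq> beliefs" and "\<nu> \<in> convex hull N"
  shows "\<exists>\<mu>\<in>N. belief_expectation \<mu> (\<lambda>w. sender_utility st b w (optimal_action st (D \<nu> \<mu>))) < - b\<^sup>2"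
proof (rule ccontr)
  assume neg: "\<not> ?thesis"
  define a where "a \<mu> = optimal_action st (D \<nu> \<mu>)" for \<mu>
  obtain n u y where u: "\<And>i. i \<in> {1..n::nat} \<Longrightarrow> 0 \<le> u i"
    and y: "\<And>i. i \<in> {1..n} \<Longrightarrow> y i \<in> N"
    and bal: "(\<Sum>i=1..n. u i *\<^sub>R D \<nu> (y i)) = (\<Sum>i=1..n. u i *\<^sub>R y i)"
    and one: "sum u {1..n} = 1"
    by (rule balance_weights[OF assms(4-8)]) blast
  have baln: "(\<Sum>i=1..n. u i * D \<nu> (y i) $ w) = (\<Sum>i=1..n. u i * y i $ w)" for w
    using arg_cong[OF bal, of "\<lambda>v. v $ w"] by simp
  \<comment> \<open>\<open>optimal_action st\<close> is linear in the belief, so the vector identity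
    \<open>bal\<close> passes to actions.\<close>
  have balm: "(\<Sum>i=1..n. u i * (a (y i) - optimal_action st (y i))) = 0"
  proof -
    have lin: "(\<Sum>i=1..n. u i * optimal_action st (f i)) = (\<Sum>w\<in>UNIV. (\<Sum>i=1..n. u i * f i $ w) * st w)" for f
      unfolding optimal_action_def belief_expectation_def sum_distrib_left sum_distrib_right
      by (subst sum.swap) (simp only: mult.assoc)
    show ?thesis
      by (simp only: a_def right_diff_distrib sum_subtractf lin baln diff_self)
  qed
  \<comment> \<open>Expand the square around \<open>a \<mu> - st w\<close>: the terms
    \<open>b\<^sup>2\<close> cancel and the cross term gives the right-hand side, whatever the sign
    of \<open>b\<close>.\<close>
  have le: "(\<Sum>w\<in>UNIV. \<mu> $ w * (a \<mu> - st w)\<^sup>2) \<le> 2 * b * (a \<mu> - optimal_action st \<mu>)" if "\<mu> \<in> N" for \<mu>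
  proof -
    have \<mu>: "(\<Sum>w\<in>UNIV. \<mu> $ w) = 1" using that assms(7) beliefs_sum by blast
    have "- b\<^sup>2 \<le> (\<Sum>w\<in>UNIV. \<mu> $ w * (- (a \<mu> - (st w + b))\<^sup>2))"
      using neg that unfolding belief_expectation_def sender_utility_def a_def by force
    also have "\<dots> = (\<Sum>w\<in>UNIV. - (\<mu> $ w * (a \<mu> - st w)\<^sup>2) + (2 * b * a \<mu> - b\<^sup>2) * \<mu> $ w
                      - 2 * b * (\<mu> $ w * st w))"
      by (rule sum.cong) (auto simp: power2_eq_square algebra_simps)
    also have "\<dots> = - (\<Sum>w\<in>UNIV. \<mu> $ w * (a \<mu> - st w)\<^sup>2) + (2 * b * a \<mu> - b\<^sup>2)
                      - 2 * b * optimal_action st \<mu>"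
      unfolding optimal_action_def belief_expectation_def
      by (simp only: sum.distrib sum_subtractf sum_distrib_left[symmetric] sum_negf \<mu> mult_1_right)
    finally show ?thesis by (simp add: algebra_simps)
  qed
  define q where "q i = u i * (\<Sum>w\<in>UNIV. y i $ w * (a (y i) - st w)\<^sup>2)" for i
  have q0: "0 \<le> q i" if "i \<in> {1..n}" for i
    unfolding q_def using u[OF that] y[OF that] assms(7)
    by (intro mult_nonneg_nonneg sum_nonneg) (auto simp: beliefs_nonneg)
  have "sum q {1..n} \<le> (\<Sum>i=1..n. 2 * b * (u i * (a (y i) - optimal_action st (y i))))"
  proof (rule sum_mono)
    fix i assume i: "i \<in> {1..n}"
    show "q i \<le> 2 * b * (u i * (a (y i) - optimal_action st (y i)))"
      using mult_left_mono[OF le[OF y[OF i]] u[OF i]] by (simp add: q_def algebra_simps)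
  qed
  also have "\<dots> = 0" using balm by (simp only: sum_distrib_left[symmetric] mult_zero_right)
  finally have "sum q {1..n} = 0" using q0 by (meson order_antisym sum_nonneg)
  then have qz: "q i = 0" if "i \<in> {1..n}" for i
    using that sum_nonneg_eq_0_iff[of "{1..n}" q] q0 by blast
  \<comment> \<open>The weighted squared errors are nonnegative and sum to zero, so each one with
    positive weight vanishes.\<close>
  have act: "a (y i) = st w" if "i \<in> {1..n}" "0 < u i" "0 < y i $ w" for i w
  proof -
    have "(\<Sum>w\<in>UNIV. y i $ w * (a (y i) - st w)\<^sup>2) = 0"
      using qz[OF that(1)] that(2) by (simp add: q_def)
    then have "y i $ w * (a (y i) - st w)\<^sup>2 = 0"
      using y[OF that(1)] assms(7) by (subst (asm) sum_nonneg_eq_0_iff) (auto simp: beliefs_nonneg)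
    then show ?thesis using that(3) by simp
  qed
  obtain w where w: "\<And>w'. st w \<le> st w'"
    using ex_is_arg_min_if_finite[of "UNIV :: 'w set" st] by (auto simp: is_arg_min_def not_less)
  have fs: "D \<nu> (y i) \<in> full_support_beliefs" if "i \<in> {1..n}" for i
    using assms(3,5,7) y[OF that] by (auto simp: interior_bias_def)
  \<comment> \<open>Otherwise coordinate \<open>w\<close> of the averaged posteriors is zero, hence
    by balance also that of the averaged distorted beliefs. These are all positive at
    \<open>w\<close>, so every \<open>u i\<close> would be zero.\<close>
  have "\<exists>i\<in>{1..n}. 0 < u i * y i $ w"
  proof (rule ccontr)
    assume "\<not> ?thesis"
    then have "(\<Sum>i=1..n. u i * y i $ w) \<le> 0" by (intro sum_nonpos) force
    then have le0: "(\<Sum>i=1..n. u i * D \<nu> (y i) $ w) \<le> 0" by (simp only: baln)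
    have nn: "0 \<le> u i * D \<nu> (y i) $ w" if "i \<in> {1..n}" for i
      using u[OF that] full_support_pos[OF fs[OF that], of w] by simp
    have "(\<Sum>i=1..n. u i * D \<nu> (y i) $ w) = 0"
      using le0 nn by (meson order_antisym sum_nonneg)
    then have "\<forall>i\<in>{1..n}. u i * D \<nu> (y i) $ w = 0"
      using nn by (subst (asm) sum_nonneg_eq_0_iff) auto
    then have "\<forall>i\<in>{1..n}. u i = 0" using full_support_pos[OF fs] by (metis less_irrefl mult_eq_0_iff)
    then show False using one by simp
  qed
  then obtain i where i: "i \<in> {1..n}" and "0 < u i * y i $ w" by blast
  then have "0 < u i" "0 < y i $ w" using u[OF i] by (auto simp: zero_less_mult_iff)
  then have "a (y i) = st w" using act i by blast
  moreover have "st w < a (y i)"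
    unfolding a_def using optimal_action_gt_minimal_state[OF assms(1,2) fs[OF i] w] .
  ultimately show False by simp
qed

section \<open>Signal distributions, repeated revelation and its payoff\<close>

lemma pmf_of_weights:
  fixes f :: "'x \<Rightarrow> real"
  assumes "finite S" and "\<And>x. x \<in> S \<Longrightarrow> 0 \<le> f x" and "sum f S = 1"
  shows "\<exists>p. set_pmf p \<subseteq> S \<and> (\<forall>x\<in>S. pmf p x = f x)"
proof -
  define g where "g x = (if x \<in> S then f x else 0)" for x
  have g0: "0 \<le> g x" for x using assms(2) by (simp add: g_def)
  have "(\<integral>\<^sup>+ x. ennreal (g x) \<partial>count_space UNIV) = (\<Sum>x\<in>S. ennreal (g x))"
    using assms(1) by (intro nn_integral_count_space') (auto simp: g_def)
  also have "\<dots> = ennreal (sum g S)" using g0 by (simp add: sum_ennreal)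
  also have "sum g S = 1" using assms(3) by (simp add: g_def)
  finally have int1: "(\<integral>\<^sup>+ x. ennreal (g x) \<partial>count_space UNIV) = 1" by simp
  have "pmf (embed_pmf g) x = g x" for x by (rule pmf_embed_pmf[OF g0 int1])
  then show ?thesis by (intro exI[of _ "embed_pmf g"]) (auto simp: set_pmf_iff g_def split: if_splits)
qed

lemma bias_iterate_full_support:
  assumes "interior_bias D" and "\<nu> \<in> full_support_beliefs" and "\<nu>' \<in> beliefs"
  shows "bias_iterate D n \<nu> \<nu>' \<in> full_support_beliefs"
  using assms by (induction n) (auto simp: interior_bias_def)

text \<open>Only state \<open>w\<close> emits \<open>y w\<close>, so the normalizing sum is
  \<open>\<nu> $ w\<close>, which full support keeps away from zero.\<close>

lemma bayes_posterior_reveal: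
  assumes "\<nu> \<in> full_support_beliefs" and "inj y"
  shows "bayes_posterior \<nu> (\<lambda>w. return_pmf (y w)) (y w) = point_mass w"
proof -
  have "(\<Sum>w'\<in>UNIV. \<nu> $ w' * pmf (return_pmf (y w')) (y w)) = (\<Sum>w'\<in>UNIV. if w' = w then \<nu> $ w' else 0)"
    using assms(2) by (intro sum.cong) (auto simp: indicator_def inj_eq)
  then have "(\<Sum>w'\<in>UNIV. \<nu> $ w' * pmf (return_pmf (y w')) (y w)) = \<nu> $ w" by simp
  then show ?thesis
    using full_support_pos[OF assms(1), of w] assms(2)
    by (auto simp: bayes_posterior_def vec_eq_iff point_mass_nth indicator_def inj_eq)
qed

text \<open>The stage is read off the first signal and the length of the rest, so the values of
  \<open>y\<close> may coincide with signals of \<open>\<pi>\<close>. The signal \<open>z\<close>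
  triggers \<open>n\<close> revelations; any other first signal ends persuasion.\<close>

definition reveal_after ::
  "('w::finite, 'x) info_structure \<Rightarrow> 'x \<Rightarrow> ('w \<Rightarrow> 'x) \<Rightarrow> nat \<Rightarrow> ('w, 'x) strategy" where
  "reveal_after \<pi> z y n h = (case h of [] \<Rightarrow> Some \<pi>
     | x # g \<Rightarrow> if x = z \<and> length g < n then Some (\<lambda>w. return_pmf (y w)) else None)"

text \<open>After \<open>z\<close> the state dictates every later signal, so only a constant tail
  has positive probability. The empty tail is listed separately because it is possible after any
  first signal.\<close>

lemma history_prob_reveal_after:
  "history_prob (reveal_after \<pi> z y n) w (x # g) =
     pmf (\<pi> w) x * (if g = [] \<or> x = z \<and> length g \<le> n \<and> g = replicate (length g) (y w) then 1 else 0)"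
proof (induction g rule: rev_induct)
  case Nil
  have "reveal_after \<pi> z y n [] = Some \<pi>" by (simp add: reveal_after_def)
  then show ?case using history_prob_snoc[of "reveal_after \<pi> z y n" w "[]" x] by simp
next
  case (snoc t g)
  have "history_prob (reveal_after \<pi> z y n) w (x # g @ [t]) =
      history_prob (reveal_after \<pi> z y n) w (x # g) *
        (if x = z \<and> length g < n then (if t = y w then 1 else 0) else 0)"
    using history_prob_snoc[of "reveal_after \<pi> z y n" w "x # g" t]
    by (auto simp: reveal_after_def[of _ _ _ _ "x # g"] indicator_def)
  moreover have "g @ [t] = replicate (length (g @ [t])) (y w) \<longleftrightarrow> g = replicate (length g) (y w) \<and> t = y w"
    by (simp add: replicate_append_same[symmetric])
  ultimately show ?case using snoc.IH by auto
qed

lemma reveal_after_strategy: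
  assumes "\<pi> \<in> info_structures X" and "range y \<subseteq> X"
  shows "reveal_after \<pi> z y n \<in> persuasion_strategies X"
proof -
  have "(\<lambda>w. return_pmf (y w)) \<in> info_structures X"
    using assms(2) by (auto simp: info_structures_def)
  then have "\<forall>h\<in>lists X. \<forall>\<pi>'. reveal_after \<pi> z y n h = Some \<pi>' \<longrightarrow> \<pi>' \<in> info_structures X"
    using assms(1) by (auto simp: reveal_after_def split: list.splits if_splits)
  \<comment> \<open>A history of length \<open>n + 2\<close> would need \<open>n + 1\<close>
    revelations.\<close>
  moreover have "\<not> realizable (reveal_after \<pi> z y n) (map x [0..<Suc (Suc n)])" for x
  proof -
    have "map x [0..<Suc (Suc n)] = x 0 # map x [1..<Suc (Suc n)]"
      by (subst upt_conv_Cons) auto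
    then show ?thesis
      by (auto simp: realizable_def history_prob_reveal_after simp del: upt_Suc)
  qed
  ultimately show ?thesis unfolding persuasion_strategies_def by blast
qed

text \<open>An inclusion suffices: the right-hand side may contain histories of probability zero,
  which do not affect the payoff sum.\<close>

lemma terminal_reveal_after:
  assumes "\<And>w. set_pmf (\<pi> w) \<subseteq> S"
  shows "terminal_histories (reveal_after \<pi> z y n) \<subseteq>
    (\<lambda>x. [x]) ` (S - {z}) \<union> (\<lambda>w. z # replicate n (y w)) ` UNIV"
proof
  fix h assume "h \<in> terminal_histories (reveal_after \<pi> z y n)"
  then have none: "reveal_after \<pi> z y n h = None" and "realizable (reveal_after \<pi> z y n) h"
    by (auto simp: terminal_histories_def)
  then obtain w where w: "0 < history_prob (reveal_after \<pi> z y n) w h" by (auto simp: realizable_def)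
  obtain x g where h: "h = x # g" using none by (cases h) (auto simp: reveal_after_def)
  have "pmf (\<pi> w) x \<noteq> 0" using w by (auto simp: h history_prob_reveal_after)
  then have x: "x \<in> S" using assms[of w] by (auto simp: set_pmf_iff)
  have g: "g = [] \<or> x = z \<and> length g \<le> n \<and> g = replicate (length g) (y w)"
    using w by (simp add: h history_prob_reveal_after split: if_splits)
  have t: "x \<noteq> z \<or> n \<le> length g" using none by (auto simp: h reveal_after_def split: if_splits)
  show "h \<in> (\<lambda>x. [x]) ` (S - {z}) \<union> (\<lambda>w. z # replicate n (y w)) ` UNIV"
  proof (cases "x = z")
    case True
    then have "g = replicate n (y w)" using g t by auto
    then show ?thesis using True h by blast
  next
    case False
    then show ?thesis using g x h by auto
  qed
qed

lemma receiver_belief_single: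
  "receiver_belief D \<mu>0 (reveal_after \<pi> z y n) [x] = D \<mu>0 (bayes_posterior \<mu>0 \<pi> x)"
  by (simp add: receiver_belief_def reveal_after_def)

lemma receiver_belief_reveal:
  assumes "interior_bias D" and "inj y" and "D \<mu>0 (bayes_posterior \<mu>0 \<pi> z) \<in> full_support_beliefs"
  shows "receiver_belief D \<mu>0 (reveal_after \<pi> z y n) (z # replicate n (y w)) =
    bias_iterate D n (D \<mu>0 (bayes_posterior \<mu>0 \<pi> z)) (point_mass w)"
proof -
  \<comment> \<open>The shift by one accounts for the first signal \<open>z\<close>. The history
    stays fixed while \<open>k\<close> grows, and interiority keeps each belief in full support, so
    each revelation has a point mass as Bayesian posterior.\<close>
  have "belief_after D \<mu>0 (reveal_after \<pi> z y n) (z # replicate n (y w)) (Suc k) =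
      bias_iterate D k (D \<mu>0 (bayes_posterior \<mu>0 \<pi> z)) (point_mass w)" if "k \<le> n" for k
    using that
  proof (induction k)
    case 0
    show ?case by (simp add: reveal_after_def)
  next
    case (Suc k)
    have "reveal_after \<pi> z y n (take (Suc k) (z # replicate n (y w))) = Some (\<lambda>w. return_pmf (y w))"
      using Suc.prems by (simp add: reveal_after_def)
    moreover have "(z # replicate n (y w)) ! Suc k = y w" using Suc.prems by simp
    ultimately show ?case
      using Suc bayes_posterior_reveal[OF bias_iterate_full_support[OF assms(1,3) point_mass_beliefs] assms(2)]
      by (simp only: belief_after.simps(2)[of _ _ _ _ "Suc k"] bias_iterate.simps option.sel Suc_leD)
  qed
  from this[of n] show ?thesis by (simp add: receiver_belief_def)
qed

lemma sequential_payoff_reveal_after: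
  fixes D :: "'w::finite bias" and \<pi> :: "('w, 'x) info_structure"
  assumes "interior_bias D" and "inj y" and "D \<mu>0 (bayes_posterior \<mu>0 \<pi> z) \<in> full_support_beliefs"
    and "finite S" and S: "\<And>w. set_pmf (\<pi> w) \<subseteq> S" and "0 < n"
  shows "sequential_payoff st b D \<mu>0 (reveal_after \<pi> z y n) =
    belief_expectation \<mu>0 (\<lambda>w.
      (\<Sum>x\<in>S - {z}. pmf (\<pi> w) x *
        sender_utility st b w (optimal_action st (D \<mu>0 (bayes_posterior \<mu>0 \<pi> x)))) +
      pmf (\<pi> w) z * sender_utility st b w (optimal_action st
        (bias_iterate D n (D \<mu>0 (bayes_posterior \<mu>0 \<pi> z)) (point_mass w))))"
proof -
  define \<sigma> where "\<sigma> = reveal_after \<pi> z y n"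
  define A where "A = (\<lambda>x. [x]) ` (S - {z})"
  define B where "B = range (\<lambda>w. z # replicate n (y w))"
  have fin: "finite A" "finite B" using assms(4) by (auto simp: A_def B_def)
  have disj: "A \<inter> B = {}" by (auto simp: A_def B_def)
  have none: "\<sigma> h = None" if "h \<in> A \<union> B" for h
    using that by (auto simp: A_def B_def \<sigma>_def reveal_after_def split: if_splits)
  have "(\<Sum>h\<in>terminal_histories \<sigma>. history_prob \<sigma> w h * f h) =
      (\<Sum>x\<in>S - {z}. pmf (\<pi> w) x * f [x]) + pmf (\<pi> w) z * f (z # replicate n (y w))"
    for w and f :: "'x list \<Rightarrow> real"
  proof -
    have "(\<Sum>h\<in>terminal_histories \<sigma>. history_prob \<sigma> w h * f h) = (\<Sum>h\<in>A \<union> B. history_prob \<sigma> w h * f h)"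
    proof (rule sum.mono_neutral_left)
      show "terminal_histories \<sigma> \<subseteq> A \<union> B"
        using terminal_reveal_after[of \<pi> S z y n, OF S] by (simp add: \<sigma>_def A_def B_def)
      show "\<forall>h\<in>A \<union> B - terminal_histories \<sigma>. history_prob \<sigma> w h * f h = 0"
        using none history_prob_nonneg[of \<sigma> w]
        by (force simp: terminal_histories_def realizable_def less_le)
    qed (use fin in simp)
    also have "\<dots> = (\<Sum>h\<in>A. history_prob \<sigma> w h * f h) + (\<Sum>h\<in>B. history_prob \<sigma> w h * f h)"
      using fin disj by (rule sum.union_disjoint)
    also have "(\<Sum>h\<in>A. history_prob \<sigma> w h * f h) = (\<Sum>x\<in>S - {z}. pmf (\<pi> w) x * f [x])"
      unfolding A_def
      by (subst sum.reindex) (auto simp: inj_on_def \<sigma>_def history_prob_reveal_after)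
    also have "(\<Sum>h\<in>B. history_prob \<sigma> w h * f h) =
        pmf (\<pi> w) z * f (z # replicate n (y w))"
      unfolding B_def
    \<comment> \<open>Since \<open>0 < n\<close>, the tail identifies the state; with no revelations
      all states would share one history. Given \<open>w\<close>, only its own history survives in
      the sum.\<close>
    proof (subst sum.reindex)
      show "inj (\<lambda>w. z # replicate n (y w))"
        using assms(2,6) by (auto simp: inj_def replicate_eq_replicate)
    qed (use assms(2,6) in \<open>auto simp: \<sigma>_def history_prob_reveal_after replicate_eq_replicate
          inj_eq if_distrib if_distribR cong: if_cong\<close>)
    finally show ?thesis .
  qed
  then show ?thesis
    unfolding sequential_payoff_def \<sigma>_def
    by (simp add: receiver_belief_single receiver_belief_reveal[OF assms(1-3)])
qed

text \<open>Bayes' rule read backwards: state \<open>w\<close> sends the signal of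
  \<open>\<mu>\<close> with probability \<open>pmf \<tau> \<mu> * \<mu> $ w / \<mu>0 $ w\<close>.
  These add up to one because \<open>\<tau>\<close> averages to the prior; infinitely many signals
  leave room for an injective labelling \<open>g\<close>.\<close>

lemma splitting_info_structure:
  fixes \<mu>0 :: "real ^ 'w::finite" and X :: "'x set"
  assumes "infinite X" and "\<mu>0 \<in> full_support_beliefs" and "\<tau> \<in> belief_splittings \<mu>0"
  obtains \<pi> :: "('w, 'x) info_structure" and g
  where "\<pi> \<in> info_structures X" and "inj_on g (set_pmf \<tau>)"
    and "\<And>w. set_pmf (\<pi> w) \<subseteq> g ` set_pmf \<tau>"
    and "\<And>w \<mu>. \<mu> \<in> set_pmf \<tau> \<Longrightarrow> \<mu>0 $ w * pmf (\<pi> w) (g \<mu>) = pmf \<tau> \<mu> * \<mu> $ w"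
    and "\<And>\<mu>. \<mu> \<in> set_pmf \<tau> \<Longrightarrow> bayes_posterior \<mu>0 \<pi> (g \<mu>) = \<mu>"
proof -
  define N where "N = set_pmf \<tau>"
  have N: "finite N" "N \<subseteq> beliefs" "(\<Sum>\<mu>\<in>N. pmf \<tau> \<mu> *\<^sub>R \<mu>) = \<mu>0"
    using assms(3) by (auto simp: belief_splittings_def N_def)
  note pos = full_support_pos[OF assms(2)]
  obtain C where C: "C \<subseteq> X" "finite C" "card C = card N"
    using infinite_arbitrarily_large[OF assms(1)] by metis
  then obtain g where g: "bij_betw g N C"
    using N(1) finite_same_card_bij by metis
  have inj: "inj_on g N" and gC: "g ` N = C" using g by (auto simp: bij_betw_def)
  have "\<exists>p. set_pmf p \<subseteq> C \<and> (\<forall>x\<in>C. pmf p x = pmf \<tau> (inv_into N g x) * inv_into N g x $ w / \<mu>0 $ w)" for w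
  proof (rule pmf_of_weights)
    show "0 \<le> pmf \<tau> (inv_into N g x) * inv_into N g x $ w / \<mu>0 $ w" if "x \<in> C" for x
    proof -
      have "inv_into N g x \<in> N" using that gC by (metis inv_into_into)
      then show ?thesis using N(2) pos[of w] by (auto intro!: divide_nonneg_pos mult_nonneg_nonneg beliefs_nonneg)
    qed
    have "(\<Sum>x\<in>C. pmf \<tau> (inv_into N g x) * inv_into N g x $ w / \<mu>0 $ w) = (\<Sum>\<mu>\<in>N. pmf \<tau> \<mu> * \<mu> $ w / \<mu>0 $ w)"
      unfolding gC[symmetric] by (subst sum.reindex[OF inj]) (simp add: inv_into_f_f[OF inj])
    also have "\<dots> = \<mu>0 $ w / \<mu>0 $ w"
      by (subst (2) N(3)[symmetric]) (simp add: sum_divide_distrib)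
    finally show "(\<Sum>x\<in>C. pmf \<tau> (inv_into N g x) * inv_into N g x $ w / \<mu>0 $ w) = 1"
      using pos[of w] by simp
  qed (rule C(2))
  then obtain \<pi> where \<pi>: "\<And>w. set_pmf (\<pi> w) \<subseteq> C"
    "\<And>w x. x \<in> C \<Longrightarrow> pmf (\<pi> w) x = pmf \<tau> (inv_into N g x) * inv_into N g x $ w / \<mu>0 $ w"
    by metis
  have joint: "\<mu>0 $ w * pmf (\<pi> w) (g \<mu>) = pmf \<tau> \<mu> * \<mu> $ w" if "\<mu> \<in> N" for w \<mu>
  proof -
    have "g \<mu> \<in> C" using that gC by blast
    then show ?thesis using \<pi>(2)[of "g \<mu>" w] pos[of w] inv_into_f_f[OF inj that] by simp
  qed
  have "bayes_posterior \<mu>0 \<pi> (g \<mu>) = \<mu>" if "\<mu> \<in> N" for \<mu>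
  proof -
    \<comment> \<open>Summing the joint probabilities over states gives the total probability of the
      signal, nonzero on the support, so normalizing returns \<open>\<mu>\<close>.\<close>
    have "(\<Sum>w\<in>UNIV. \<mu>0 $ w * pmf (\<pi> w) (g \<mu>)) = pmf \<tau> \<mu>"
      using that N(2) beliefs_sum[of \<mu>] by (auto simp: joint[OF that] sum_distrib_left[symmetric])
    moreover have "pmf \<tau> \<mu> \<noteq> 0" using that by (simp add: N_def set_pmf_iff)
    ultimately show ?thesis by (simp add: bayes_posterior_def joint[OF that] vec_eq_iff)
  qed
  moreover have "\<pi> \<in> info_structures X"
    using \<pi>(1) C(1,2) finite_subset by (fastforce simp: info_structures_def)
  ultimately show thesis using that[of \<pi> g] inj gC \<pi>(1) joint by (simp add: N_def)
qed

text \<open>Eventual learning drives the action to the true state, leaving exactly the loss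
  \<open>b\<^sup>2\<close> in every state; the finite expectation is continuous in the
  actions.\<close>

lemma repeated_revelation_payoff:
  assumes "eventual_learning D" and "\<nu> \<in> full_support_beliefs" and "\<mu> \<in> beliefs"
  shows "(\<lambda>n. belief_expectation \<mu> (\<lambda>w. sender_utility st b w
      (optimal_action st (bias_iterate D n \<nu> (point_mass w))))) \<longlonglongrightarrow> - b\<^sup>2"
proof -
  have "(\<lambda>n. optimal_action st (bias_iterate D n \<nu> (point_mass w))) \<longlonglongrightarrow> st w" for w
    using assms(1,2) tendsto_optimal_action[of _ "point_mass w"]
    unfolding eventual_learning_def optimal_action_point_mass by blast
  then have "(\<lambda>n. belief_expectation \<mu> (\<lambda>w. sender_utility st b w
      (optimal_action st (bias_iterate D n \<nu> (point_mass w)))))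
    \<longlonglongrightarrow> (\<Sum>w\<in>UNIV. \<mu> $ w * (- (st w - (st w + b))\<^sup>2))"
    unfolding belief_expectation_def sender_utility_def by (intro tendsto_intros)
  also have "(\<Sum>w\<in>UNIV. \<mu> $ w * (- (st w - (st w + b))\<^sup>2)) = - b\<^sup>2"
    using beliefs_sum[OF assms(3)] by (simp add: sum_distrib_right[symmetric] sum_negf)
  finally show ?thesis .
qed

section \<open>Improving on an optimal splitting\<close>

text \<open>Attainment of the maximum is a premise because it makes \<open>one_shot_value\<close> a
  genuine maximum. With a single state every strategy would yield \<open>- b\<^sup>2\<close>, so a
  gain requires at least two.\<close>

theorem proposition4:
  fixes st :: "'w::finite \<Rightarrow> real" and D :: "'w bias" and X :: "'x set"
  assumes "inj st" and "2 \<le> CARD('w)" and "infinite X"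
    and "bias_function D" and "interior_bias D" and "eventual_learning D" and "balanced_bias D"
  shows "\<forall>b. \<forall>\<mu>0\<in>full_support_beliefs.
           (\<exists>\<tau>. is_arg_max (one_shot_payoff st b D \<mu>0) (\<lambda>\<tau>. \<tau> \<in> belief_splittings \<mu>0) \<tau>) \<longrightarrow>
           gains_from_sequential_persuasion X st b D \<mu>0"
proof (intro allI ballI impI, elim exE)
  fix b \<mu>0 \<tau>
  assume \<mu>0: "\<mu>0 \<in> full_support_beliefs"
    and opt: "is_arg_max (one_shot_payoff st b D \<mu>0) (\<lambda>\<tau>. \<tau> \<in> belief_splittings \<mu>0) \<tau>"
  define N where "N = set_pmf \<tau>"
  have \<tau>: "\<tau> \<in> belief_splittings \<mu>0" using opt by (simp add: is_arg_max_def)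
  then have N: "finite N" "N \<subseteq> beliefs" "(\<Sum>\<mu>\<in>N. pmf \<tau> \<mu> *\<^sub>R \<mu>) = \<mu>0"
    by (auto simp: belief_splittings_def N_def)
  have "sum (pmf \<tau>) N = 1" using N(1) by (simp add: N_def sum_pmf_eq_1)
  then have "\<mu>0 \<in> convex hull N"
    using N(1,3) by (auto simp: convex_hull_finite intro!: exI[of _ "pmf \<tau>"])
  define P where "P \<mu> = belief_expectation \<mu> (\<lambda>w. sender_utility st b w (optimal_action st (D \<mu>0 \<mu>)))" for \<mu>
  obtain \<mu> where \<mu>: "\<mu> \<in> N" and low: "P \<mu> < - b\<^sup>2"
    using low_payoff_posterior[OF assms(1,2,5,7) \<mu>0 N(1,2) \<open>\<mu>0 \<in> convex hull N\<close>]
    unfolding P_def by blast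
  define R where "R n = belief_expectation \<mu> (\<lambda>w. sender_utility st b w
      (optimal_action st (bias_iterate D n (D \<mu>0 \<mu>) (point_mass w))))" for n
  have fs: "D \<mu>0 \<mu> \<in> full_support_beliefs"
    using assms(5) \<mu>0 \<mu> N(2) by (auto simp: interior_bias_def)
  have "R \<longlonglongrightarrow> - b\<^sup>2"
    unfolding R_def using repeated_revelation_payoff[OF assms(6) fs] \<mu> N(2) by blast
  then have "eventually (\<lambda>n. P \<mu> < R n) sequentially" using low by (rule order_tendstoD)
  then obtain m where "\<And>n. m \<le> n \<Longrightarrow> P \<mu> < R n" by (auto simp: eventually_sequentially)
  \<comment> \<open>A positive \<open>n\<close> is chosen because the payoff formula for
    \<open>reveal_after\<close> requires one.\<close>
  then obtain n where n: "0 < n" "P \<mu> < R n" by (metis le_add2 zero_less_Suc plus_1_eq_Suc)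
  obtain \<pi> :: "('w, 'x) info_structure" and g where \<pi>: "\<pi> \<in> info_structures X" "inj_on g N"
    "\<And>w. set_pmf (\<pi> w) \<subseteq> g ` N"
    "\<And>w \<mu>. \<mu> \<in> N \<Longrightarrow> \<mu>0 $ w * pmf (\<pi> w) (g \<mu>) = pmf \<tau> \<mu> * \<mu> $ w"
    "\<And>\<mu>. \<mu> \<in> N \<Longrightarrow> bayes_posterior \<mu>0 \<pi> (g \<mu>) = \<mu>"
    using splitting_info_structure[OF assms(3) \<mu>0 \<tau>] unfolding N_def by metis
  obtain C where C: "C \<subseteq> X" "finite C" "card C = CARD('w)"
    using infinite_arbitrarily_large[OF assms(3)] by metis
  then obtain y where "bij_betw y (UNIV :: 'w set) C"
    by (metis finite finite_same_card_bij)
  then have y: "inj y" "range y \<subseteq> X" using C(1) by (auto simp: bij_betw_def)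
  define \<sigma> where "\<sigma> = reveal_after \<pi> (g \<mu>) y n"
  have "g ` N - {g \<mu>} = g ` (N - {\<mu>})" using \<pi>(2) \<mu> by (auto dest: inj_onD)
  then have "sequential_payoff st b D \<mu>0 \<sigma> = belief_expectation \<mu>0 (\<lambda>w.
      (\<Sum>\<mu>'\<in>N - {\<mu>}. pmf (\<pi> w) (g \<mu>') * sender_utility st b w (optimal_action st (D \<mu>0 \<mu>'))) +
      pmf (\<pi> w) (g \<mu>) * sender_utility st b w (optimal_action st
        (bias_iterate D n (D \<mu>0 \<mu>) (point_mass w))))"
    unfolding \<sigma>_def using fs N(1) n(1)
    by (subst sequential_payoff_reveal_after[where S = "g ` N"])
       (simp_all add: assms(5) y(1) \<pi>(3,5) \<mu> sum.reindex[OF inj_on_subset[OF \<pi>(2)]])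
  \<comment> \<open>Exchange the sums over states and signals; the joint law then turns prior times
    signal probability into signal weight times posterior.\<close>
  also have "\<dots> = (\<Sum>\<mu>'\<in>N - {\<mu>}. pmf \<tau> \<mu>' * P \<mu>') + pmf \<tau> \<mu> * R n"
    unfolding belief_expectation_def P_def R_def distrib_left sum.distrib sum_distrib_left
    by (subst sum.swap) (simp add: mult.assoc[symmetric] \<pi>(4) \<mu>)
  finally have seq: "sequential_payoff st b D \<mu>0 \<sigma> =
      (\<Sum>\<mu>'\<in>N - {\<mu>}. pmf \<tau> \<mu>' * P \<mu>') + pmf \<tau> \<mu> * R n" .
  have "one_shot_value st b D \<mu>0 = (\<Sum>\<mu>'\<in>N. pmf \<tau> \<mu>' * P \<mu>')"
    using one_shot_value_eq[OF opt] by (simp add: one_shot_payoff_def P_def N_def)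
  also have "\<dots> = pmf \<tau> \<mu> * P \<mu> + (\<Sum>\<mu>'\<in>N - {\<mu>}. pmf \<tau> \<mu>' * P \<mu>')"
    using N(1) \<mu> by (rule sum.remove)
  \<comment> \<open>The two payoffs differ only in the summand of \<open>\<mu>\<close>, whose weight
    is positive.\<close>
  also have "\<dots> < sequential_payoff st b D \<mu>0 \<sigma>"
    using n(2) \<mu> by (simp add: seq N_def pmf_positive)
  finally show "gains_from_sequential_persuasion X st b D \<mu>0"
    unfolding gains_from_sequential_persuasion_def
    using reveal_after_strategy[OF \<pi>(1) y(2)] \<sigma>_def by blast
qed

end
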